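(* PA is consistent.
   Context: PA is first-order Peano Arithmetic over the symbols $0, {}', +, \star, =$, with standard first-order predicate calculus as underlying logic, axioms PA$_1$ $(x_1=x_2)\to((x_1=x_3)\to(x_2=x_3))$; PA$_2$ $(x_1=x_2)\to(x_1'=x_2')$; PA$_3$ $0\neq x_1'$; PA$_4$ $(x_1'=x_2')\to(x_1=x_2)$; PA$_5$ $x_1+0=x_1$; PA$_6$ $x_1+x_2'=(x_1+x_2)'$; PA$_7$ $x_1\star 0=0$; PA$_8$ $x_1\star x_2'=(x_1\star x_2)+x_1$; PA$_9$ (schema) $F(0)\to(((\forall x)(F(x)\to F(x')))\to(\forall x)F(x))$; and the rules Generalisation and Modus Ponens. A formal system $S$ is (simply) consistent iff there is no $S$-formula $[F(x)]$ for which both $[(\forall x)F(x)]$ and $[\neg(\forall x)F(x)]$ are $S$-provable. *)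

theory Defs
  imports Main
begin

text \<open>The variable \<open>x\<^sub>i\<close> is \<open>Var i\<close>. The connectives \<open>\<and>\<close>, \<open>\<or>\<close> and
  the quantifier \<open>\<exists>\<close> are the usual abbreviations of the primitives below.\<close>

datatype tm =
    Var nat
  | Zero
  | Succ tm
  | Plus tm tm
  | Times tm tm

datatype fm =
    Eq tm tm
  | Neg fm
  | Imp fm fm
  | All nat fm

primrec vars_tm :: "tm \<Rightarrow> nat set" where
  "vars_tm (Var y) = {y}"
| "vars_tm Zero = {}"
| "vars_tm (Succ s) = vars_tm s"
| "vars_tm (Plus s u) = vars_tm s \<union> vars_tm u"
| "vars_tm (Times s u) = vars_tm s \<union> vars_tm u"

primrec free_vars :: "fm \<Rightarrow> nat set" where
  "free_vars (Eq s u) = vars_tm s \<union> vars_tm u"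
| "free_vars (Neg F) = free_vars F"
| "free_vars (Imp F G) = free_vars F \<union> free_vars G"
| "free_vars (All y F) = free_vars F - {y}"

primrec subst_tm :: "nat \<Rightarrow> tm \<Rightarrow> tm \<Rightarrow> tm" where
  "subst_tm x t (Var y) = (if y = x then t else Var y)"
| "subst_tm x t Zero = Zero"
| "subst_tm x t (Succ s) = Succ (subst_tm x t s)"
| "subst_tm x t (Plus s u) = Plus (subst_tm x t s) (subst_tm x t u)"
| "subst_tm x t (Times s u) = Times (subst_tm x t s) (subst_tm x t u)"

text \<open>\<open>subst x t F\<close> replaces the free occurrences of \<open>x\<close> in \<open>F\<close> by \<open>t\<close>. Bound variables
  are not renamed, so it may capture; \<open>free_for\<close> is the proviso that excludes this.\<close>

primrec subst :: "nat \<Rightarrow> tm \<Rightarrow> fm \<Rightarrow> fm" where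
  "subst x t (Eq s u) = Eq (subst_tm x t s) (subst_tm x t u)"
| "subst x t (Neg F) = Neg (subst x t F)"
| "subst x t (Imp F G) = Imp (subst x t F) (subst x t G)"
| "subst x t (All y F) = (if y = x then All y F else All y (subst x t F))"

primrec free_for :: "tm \<Rightarrow> nat \<Rightarrow> fm \<Rightarrow> bool" where
  "free_for t x (Eq s u) \<longleftrightarrow> True"
| "free_for t x (Neg F) \<longleftrightarrow> free_for t x F"
| "free_for t x (Imp F G) \<longleftrightarrow> free_for t x F \<and> free_for t x G"
| "free_for t x (All y F) \<longleftrightarrow> x \<notin> free_vars (All y F) \<or> (y \<notin> vars_tm t \<and> free_for t x F)"

text \<open>A formal system is given by its set \<open>S\<close> of proper axioms. The logical axioms are those of
  the usual Hilbert calculus with primitives \<open>\<not>\<close>, \<open>\<longrightarrow>\<close>, \<open>\<forall>\<close>. Equality has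
  no logical axioms: it is a binary predicate symbol governed by the proper axioms.\<close>

inductive provable :: "fm set \<Rightarrow> fm \<Rightarrow> bool" for S :: "fm set" where
  Proper: "F \<in> S \<Longrightarrow> provable S F"
| L1: "provable S (Imp F (Imp G F))"
| L2: "provable S (Imp (Imp F (Imp G H)) (Imp (Imp F G) (Imp F H)))"
| L3: "provable S (Imp (Imp (Neg G) (Neg F)) (Imp (Imp (Neg G) F) G))"
| L4: "free_for t x F \<Longrightarrow> provable S (Imp (All x F) (subst x t F))"
| L5: "x \<notin> free_vars F \<Longrightarrow> provable S (Imp (All x (Imp F G)) (Imp F (All x G)))"
| Modus_Ponens: "provable S F \<Longrightarrow> provable S (Imp F G) \<Longrightarrow> provable S G"
| Generalisation: "provable S F \<Longrightarrow> provable S (All x F)"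

text \<open>In the induction schema, \<open>F(0)\<close> and \<open>F(x')\<close> need no proviso: \<open>Zero\<close> has no variables, and
  the only variable of \<open>Succ (Var x)\<close> is \<open>x\<close>, which is not bound at a free occurrence of \<open>x\<close>.\<close>

inductive_set PA :: "fm set" where
  PA1: "Imp (Eq (Var 1) (Var 2)) (Imp (Eq (Var 1) (Var 3)) (Eq (Var 2) (Var 3))) \<in> PA"
| PA2: "Imp (Eq (Var 1) (Var 2)) (Eq (Succ (Var 1)) (Succ (Var 2))) \<in> PA"
| PA3: "Neg (Eq Zero (Succ (Var 1))) \<in> PA"
| PA4: "Imp (Eq (Succ (Var 1)) (Succ (Var 2))) (Eq (Var 1) (Var 2)) \<in> PA"
| PA5: "Eq (Plus (Var 1) Zero) (Var 1) \<in> PA"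
| PA6: "Eq (Plus (Var 1) (Succ (Var 2))) (Succ (Plus (Var 1) (Var 2))) \<in> PA"
| PA7: "Eq (Times (Var 1) Zero) Zero \<in> PA"
| PA8: "Eq (Times (Var 1) (Succ (Var 2))) (Plus (Times (Var 1) (Var 2)) (Var 1)) \<in> PA"
| PA9: "Imp (subst x Zero F)
          (Imp (All x (Imp F (subst x (Succ (Var x)) F))) (All x F)) \<in> PA"

definition consistent :: "fm set \<Rightarrow> bool" where
  "consistent S \<longleftrightarrow> \<not> (\<exists>F x. provable S (All x F) \<and> provable S (Neg (All x F)))"

end

theory Submission
  imports Defs
begin

text \<open>Every provable formula is true in the standard model \<open>nat\<close> under every assignment: the
  axioms are true and the rules preserve truth. A formula and its negation are never both true.\<close>

primrec val :: "(nat \<Rightarrow> nat) \<Rightarrow> tm \<Rightarrow> nat" where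
  "val e (Var y) = e y"
| "val e Zero = 0"
| "val e (Succ s) = Suc (val e s)"
| "val e (Plus s u) = val e s + val e u"
| "val e (Times s u) = val e s * val e u"

primrec sat :: "(nat \<Rightarrow> nat) \<Rightarrow> fm \<Rightarrow> bool" where
  "sat e (Eq s u) \<longleftrightarrow> val e s = val e u"
| "sat e (Neg F) \<longleftrightarrow> \<not> sat e F"
| "sat e (Imp F G) \<longleftrightarrow> (sat e F \<longrightarrow> sat e G)"
| "sat e (All y F) \<longleftrightarrow> (\<forall>n. sat (e(y := n)) F)"

lemma val_cong: "(\<And>y. y \<in> vars_tm t \<Longrightarrow> e y = e' y) \<Longrightarrow> val e t = val e' t"
  by (induction t) auto

text \<open>Under a quantifier the two assignments may differ at the bound variable
  \<open>y\<close>, but once both send \<open>y\<close> to \<open>n\<close> they agree on all free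
  variables of the body.\<close>

lemma sat_cong: "(\<And>y. y \<in> free_vars F \<Longrightarrow> e y = e' y) \<Longrightarrow> sat e F \<longleftrightarrow> sat e' F"
proof (induction F arbitrary: e e')
  case (Eq s u)
  then have "val e s = val e' s" "val e u = val e' u"
    by (auto intro: val_cong)
  then show ?case by simp
next
  case (Neg F)
  have "sat e F \<longleftrightarrow> sat e' F" by (rule Neg.IH) (simp add: Neg.prems)
  then show ?case by simp
next
  case (Imp F G)
  have "sat e F \<longleftrightarrow> sat e' F" by (rule Imp.IH) (simp add: Imp.prems)
  moreover have "sat e G \<longleftrightarrow> sat e' G" by (rule Imp.IH) (simp add: Imp.prems)
  ultimately show ?case by simp
next
  case (All y F)
  have "sat (e(y := n)) F \<longleftrightarrow> sat (e'(y := n)) F" for n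
    by (rule All.IH) (simp add: All.prems)
  then show ?case by simp
qed

lemma sat_upd_not_free [simp]: "x \<notin> free_vars F \<Longrightarrow> sat (e(x := n)) F \<longleftrightarrow> sat e F"
  by (rule sat_cong) auto

lemma val_upd_not_in [simp]: "x \<notin> vars_tm t \<Longrightarrow> val (e(x := n)) t = val e t"
  by (rule val_cong) auto

lemma subst_tm_not_in: "x \<notin> vars_tm s \<Longrightarrow> subst_tm x t s = s"
  by (induction s) auto

lemma subst_not_free: "x \<notin> free_vars F \<Longrightarrow> subst x t F = F"
  by (induction F) (auto simp: subst_tm_not_in)

lemma val_subst_tm: "val e (subst_tm x t s) = val (e(x := val e t)) s"
  by (induction s) auto

text \<open>The quantifier case is where capture could spoil the equivalence. If \<open>x\<close> is
  free in \<open>All y F\<close>, the proviso keeps \<open>y\<close> out of \<open>t\<close>, so the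
  value of \<open>t\<close> survives the update at \<open>y\<close> and the two updates commute.
  Otherwise, in particular if \<open>y = x\<close>, neither the substitution nor the update at
  \<open>x\<close> has any effect.\<close>

lemma sat_subst: "free_for t x F \<Longrightarrow> sat e (subst x t F) \<longleftrightarrow> sat (e(x := val e t)) F"
proof (induction F arbitrary: e)
  case (All y F)
  show ?case
  proof (cases "x \<in> free_vars (All y F)")
    case True
    then have "x \<noteq> y" "y \<notin> vars_tm t" "free_for t x F"
      using All.prems by auto
    have "sat (e(y := n)) (subst x t F) \<longleftrightarrow> sat (e(x := val e t, y := n)) F" for n
      by (simp only: All.IH[OF \<open>free_for t x F\<close>] val_upd_not_in[OF \<open>y \<notin> vars_tm t\<close>]
          fun_upd_twist[OF \<open>x \<noteq> y\<close>])
    then show ?thesis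
      using \<open>x \<noteq> y\<close> by (simp only: subst.simps sat.simps not_sym[OF \<open>x \<noteq> y\<close>] if_False)
  next
    case False
    then show ?thesis
      by (simp only: subst_not_free[OF False] sat_upd_not_free[OF False])
  qed
qed (simp_all add: val_subst_tm)

text \<open>A quantifier over \<open>x\<close> leaves no free \<open>x\<close> in its scope to
  replace, and one over another variable cannot capture anything in \<open>t\<close>. This serves
  \<open>Zero\<close> and \<open>Succ (Var x)\<close> in the induction schema.\<close>

lemma free_for_same_var: "vars_tm t \<subseteq> {x} \<Longrightarrow> free_for t x F"
  by (induction F) auto

lemma sat_PA: "F \<in> PA \<Longrightarrow> sat e F"
proof (induction rule: PA.induct)
  case (PA9 x F)
  \<comment> \<open>The schema becomes induction on \<open>nat\<close>: under
    \<open>e(x := n)\<close> the term \<open>Succ (Var x)\<close> has value \<open>Suc n\<close>,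
    and this value overwrites \<open>n\<close> at \<open>x\<close>.\<close>
  have "sat (e(x := n)) F"
    if "sat (e(x := 0)) F" "\<And>n. sat (e(x := n)) F \<Longrightarrow> sat (e(x := Suc n)) F" for n
    using that by (induction n) auto
  then show ?case
    by (simp add: sat_subst free_for_same_var)
qed auto

lemma soundness:
  assumes "provable S F" and "\<And>F e. F \<in> S \<Longrightarrow> sat e F"
  shows "sat e F"
  using assms(1)
\<comment> \<open>The assignment varies because Generalisation uses the induction hypothesis at
  every \<open>e(x := n)\<close>. For \<open>L4\<close> the quantifier is instantiated at
  \<open>val e t\<close>; for \<open>L5\<close> the truth of \<open>F\<close> does not depend on the
  value of \<open>x\<close>.\<close>
proof (induction arbitrary: e rule: provable.induct)
  case (Proper F)
  then show ?case by (rule assms(2))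
qed (auto simp: sat_subst)

theorem theorem6: "consistent PA"
proof -
  \<comment> \<open>Otherwise soundness would make \<open>F\<close> both true and false under the
    same assignment.\<close>
  have "\<not> (provable PA F \<and> provable PA (Neg F))" for F
    using soundness[of PA F] soundness[of PA "Neg F"] sat_PA by auto
  then show ?thesis
    by (simp add: consistent_def)
qed

end
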